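(* Let the stochastic game be as described in the context, and let $\phi:\prod_{i=1}^N[0,u_i^{max}]\to\mathbb{R}$ be concave, continuous and non-negative. Let $\phi^{max}$ be the maximum of $\phi$ over $\prod_{i=1}^N[0,u_i^{max}]$, and let $C=\sum_{i=1}^N(u_i^{max})^2$. Since $\phi$ is continuous on a compact set, it is Lipschitz continuous, so that there is a positive value $M$ (the Lipschitz constant) such that $|\phi(\gamma)-\phi(r)|\le M\|\gamma-r\|$ for all $\gamma,r\in\prod_{i=1}^N[0,u_i^{max}]$. Fix $V\ge 0$, let $\{\omega(t)\}_{t\ge 0}$ in $\Omega$ and $\{b(t)\}_{t\ge 0}$ in $\mathcal{A}_1\times\cdots\times\mathcal{A}_N$ be arbitrary sequences, and suppose the general algorithm (described in the context) is used with this $V$ and with $Q_i(0)=Z_i(0)=0$ for all $i\in\{1,\dots,N\}$. Then for all $t\in\{1,2,3,\dots\}$: (a) $\displaystyle \frac{\sqrt{\sum_{i=1}^N\left(Q_i(t)^2+Z_i(t)^2\right)}}{t}\le\sqrt{\frac{2C+2V\phi^{max}}{t}}$. (b) $\displaystyle \overline{u}_i(t)-\overline{x}_i(t)\ge-\sqrt{\frac{2C+2V\phi^{max}}{t}}$ for all $i\in\{1,\dots,N\}$. (c) The following constraints are satisfied: $\liminf_{t\to\infty}[\overline{u}_i(t)-\overline{x}_i(t)]\ge0$ for all $i\in\{1,\dots,N\}$, and $\alpha_i(t)\in\mathcal{A}_i$ for all $i\in\{1,\dots,N\}$ and all $t\in\{0,1,2,\dots\}$. (d) $\displaystyle \ph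i(\overline{u}(t))\ge\frac1t\sum_{\tau=0}^{t-1}\phi(\gamma(\tau))-M\sqrt{\frac{2C+2V\phi^{max}}{t}}$.
   Context: Game. $N\ge 2$ is an integer (number of players). $\Omega$ and $\mathcal{A}_1,\dots,\mathcal{A}_N$ are arbitrary nonempty sets (event set and action sets). For each $i$, $\hat{u}_i:\mathcal{A}_1\times\cdots\times\mathcal{A}_N\times\Omega\to\mathbb{R}$ is a utility function with $0\le \hat{u}_i(\alpha,\omega)\le u_i^{max}$ for all $(\alpha,\omega)$, where $u_i^{max}<\infty$. It is assumed that for every $\omega\in\Omega$ and all real $\beta_1,\dots,\beta_N$, the supremum of $\sum_{i=1}^N\beta_i\hat{u}_i(\alpha,\omega)$ over $\alpha\in\mathcal{A}_1\times\cdots\times\mathcal{A}_N$ is attained. Sequences. $\omega(t)$ is the event vector and $b(t)=(b_1(t),\dots,b_N(t))$ the vector of baseline actions on round $t\in\{0,1,2,\dots\}$. For an action sequence $\alpha(t)=(\alpha_1(t),\dots,\alpha_N(t))$ define $u_i(t)=\hat{u}_i(\alpha(t),\omega(t))$, $x_i(t)=\hat{u}_i(b(t),\omega(t))$, and for $t\geq 1$, $\overline{u}_i(t)=\frac1t\sum_{\tau=0}^{t-1}u_i(\tau)$, $\overline{x}_i(t)=\frac1t\sum_{\tau=0}^{t-1}x_i(\tau)$, $\overline{u}(t)=(\overline{u}_1(t),\dots,\overline{u}_N(t))$. General algorithm with parameter $V$. It maintains $Q(t)=(Q_1(t),\dots,Q_N(t))$ and $Z(t)=(Z_1(t),\dots,Z_N(t))$.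 On every round $t\in\{0,1,2,\dots\}$: (1) choose $\gamma(t)=(\gamma_1(t),\dots,\gamma_N(t))$ as a maximizer of $V\phi(\gamma)-\sum_{i=1}^NZ_i(t)\gamma_i$ over $\gamma\in\prod_{i=1}^N[0,u_i^{max}]$; (2) choose $\alpha(t)$ as a maximizer of $\sum_{i=1}^N\hat{u}_i(\alpha,\omega(t))[Q_i(t)+Z_i(t)]$ over $\alpha\in\mathcal{A}_1\times\cdots\times\mathcal{A}_N$; (3) update, for each $i$, $Q_i(t+1)=\max[Q_i(t)+x_i(t)-u_i(t),0]$ and $Z_i(t+1)=Z_i(t)+\gamma_i(t)-u_i(t)$. $\|\cdot\|$ is the Euclidean norm.
   Formalization: Continuity on a compact set does not imply Lipschitz continuity (e.g. the sum of square roots of the coordinates), so the existence of M is not claimed: part (d) is proved for every M>0 that is a Lipschitz constant of φ on the box; (a)–(c) need no such M. *)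

theory Defs
  imports "HOL-Analysis.Analysis"
begin

text \<open>
  Players are the elements of a finite type \<open>'n\<close>.  All action sets live in one type \<open>'a\<close>
  (pass to a disjoint union if necessary), so action profiles are functions \<open>'n \<Rightarrow> 'a\<close>.
  Maximizers are expressed by \<^const>\<open>is_arg_max\<close>, whose second argument is the
  feasibility predicate, so feasibility of the maximizer is part of it.
\<close>

definition profiles :: "('n \<Rightarrow> 'a set) \<Rightarrow> ('n \<Rightarrow> 'a) set" where
  "profiles A = Pi UNIV A"

definition stochastic_game ::
  "'w set \<Rightarrow> ('n::finite \<Rightarrow> 'a set) \<Rightarrow> ('n \<Rightarrow> ('n \<Rightarrow> 'a) \<Rightarrow> 'w \<Rightarrow> real) \<Rightarrow> real^'n \<Rightarrow> bool" where
  "stochastic_game \<Omega> A uhat umax \<longleftrightarrow>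
     \<Omega> \<noteq> {} \<and> (\<forall>i. A i \<noteq> {}) \<and>
     (\<forall>i. \<forall>a\<in>profiles A. \<forall>w\<in>\<Omega>. 0 \<le> uhat i a w \<and> uhat i a w \<le> umax $ i) \<and>
     (\<forall>w\<in>\<Omega>. \<forall>\<beta> :: real^'n. \<exists>a.
        is_arg_max (\<lambda>a. \<Sum>i\<in>UNIV. \<beta> $ i * uhat i a w) (\<lambda>a. a \<in> profiles A) a)"

text \<open>
  The box \<open>cbox 0 umax\<close> is the product of the intervals \<open>[0, umax $ i]\<close>.
  The parameters \<open>w\<close>, \<open>b\<close>, \<open>\<gamma>\<close>, \<open>\<alpha>\<close>, \<open>Q\<close>, \<open>Z\<close> are sequences indexed by the round.
\<close>

definition general_algorithm ::
  "('n::finite \<Rightarrow> 'a set) \<Rightarrow> ('n \<Rightarrow> ('n \<Rightarrow> 'a) \<Rightarrow> 'w \<Rightarrow> real) \<Rightarrow> real^'n \<Rightarrow> (real^'n \<Rightarrow> real) \<Rightarrow> real \<Rightarrow>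
   (nat \<Rightarrow> 'w) \<Rightarrow> (nat \<Rightarrow> 'n \<Rightarrow> 'a) \<Rightarrow> (nat \<Rightarrow> real^'n) \<Rightarrow> (nat \<Rightarrow> 'n \<Rightarrow> 'a) \<Rightarrow>
   (nat \<Rightarrow> real^'n) \<Rightarrow> (nat \<Rightarrow> real^'n) \<Rightarrow> bool" where
  "general_algorithm A uhat umax \<phi> V w b \<gamma> \<alpha> Q Z \<longleftrightarrow>
     (\<forall>t.
        is_arg_max (\<lambda>g. V * \<phi> g - (\<Sum>i\<in>UNIV. Z t $ i * g $ i)) (\<lambda>g. g \<in> cbox 0 umax) (\<gamma> t) \<and>
        is_arg_max (\<lambda>a. \<Sum>i\<in>UNIV. uhat i a (w t) * (Q t $ i + Z t $ i))
          (\<lambda>a. a \<in> profiles A) (\<alpha> t) \<and>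
        (\<forall>i. Q (Suc t) $ i = max (Q t $ i + uhat i (b t) (w t) - uhat i (\<alpha> t) (w t)) 0) \<and>
        (\<forall>i. Z (Suc t) $ i = Z t $ i + \<gamma> t $ i - uhat i (\<alpha> t) (w t)))"

definition time_avg :: "(nat \<Rightarrow> real) \<Rightarrow> nat \<Rightarrow> real" where
  "time_avg f t = (1 / real t) * (\<Sum>\<tau><t. f \<tau>)"

definition avg_utility ::
  "('n::finite \<Rightarrow> ('n \<Rightarrow> 'a) \<Rightarrow> 'w \<Rightarrow> real) \<Rightarrow> (nat \<Rightarrow> 'w) \<Rightarrow> (nat \<Rightarrow> 'n \<Rightarrow> 'a) \<Rightarrow> nat \<Rightarrow> real^'n" where
  "avg_utility uhat w \<alpha> t = (\<chi> i. time_avg (\<lambda>\<tau>. uhat i (\<alpha> \<tau>) (w \<tau>)) t)"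

definition phi_max :: "real^'n \<Rightarrow> (real^'n \<Rightarrow> real) \<Rightarrow> real" where
  "phi_max umax \<phi> = (SUP g\<in>cbox 0 umax. \<phi> g)"

text \<open>For continuous \<open>\<phi>\<close> the supremum is a maximum.\<close>

lemma phi_max_attained:
  assumes "continuous_on (cbox 0 umax) \<phi>" and "cbox 0 umax \<noteq> {}"
  shows "\<exists>g\<in>cbox 0 umax. \<phi> g = phi_max umax \<phi> \<and> (\<forall>r\<in>cbox 0 umax. \<phi> r \<le> \<phi> g)"
proof -
  obtain g where g: "g \<in> cbox 0 umax" "\<forall>r\<in>cbox 0 umax. \<phi> r \<le> \<phi> g"
    using continuous_attains_sup[OF compact_cbox assms(2,1)] by blast
  then have "phi_max umax \<phi> = \<phi> g"
    unfolding phi_max_def by (intro cSup_eq_maximum) auto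
  with g show ?thesis by auto
qed

end

theory Submission
  imports Defs
begin

text \<open>
  Lyapunov drift.  Put \<open>L t = (\<Sum>i. (Q t $ i)\<^sup>2 + (Z t $ i)\<^sup>2)\<close>.  One step of the algorithm raises \<open>L\<close> by at most
  \<open>2 * C\<close> plus twice the cross term \<open>Q \<bullet> (x - u) + Z \<bullet> (\<gamma> - u)\<close>.  The baseline utility vector \<open>x\<close> is
  feasible in the choice of \<open>\<gamma>\<close> and the baseline action is feasible in the choice of \<open>\<alpha>\<close>; comparing with
  both bounds the cross term by \<open>V * phi_max\<close>, so \<open>L\<close> grows at most linearly.  Finally \<open>Q t\<close> dominates
  the accumulated deficit of \<open>u\<close> against \<open>x\<close>, while \<open>Z t\<close> equals the accumulated difference of \<open>\<gamma>\<close> and \<open>u\<close>,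
  and Jensen's inequality transfers the bound on \<open>Z\<close> to \<open>\<phi>\<close>.
\<close>

lemma square_diff_le_square_bound:
  fixes a b m :: real
  assumes "0 \<le> a" "a \<le> m" "0 \<le> b" "b \<le> m"
  shows "(a - b)\<^sup>2 \<le> m\<^sup>2"
  using assms by (intro abs_le_square_iff[THEN iffD1]) auto

text \<open>Clipping at 0 cannot increase a square, so both updates can be expanded as plain
  squares. Besides the cross terms this leaves the squared increments \<open>x $ i - u $ i\<close>
  and \<open>g $ i - u $ i\<close>. Each is a difference of two points of the interval from 0 to
  \<open>m $ i\<close>, which gives the factor 2 on the sum of squares.\<close>

lemma queue_drift:
  fixes q z x u g m :: "real^'n"
  assumes "x \<in> cbox 0 m" "u \<in> cbox 0 m" "g \<in> cbox 0 m"
  shows "(\<Sum>i\<in>UNIV. (max (q $ i + x $ i - u $ i) 0)\<^sup>2 + (z $ i + g $ i - u $ i)\<^sup>2)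
    \<le> (\<Sum>i\<in>UNIV. (q $ i)\<^sup>2 + (z $ i)\<^sup>2) + 2 * (\<Sum>i\<in>UNIV. (m $ i)\<^sup>2)
      + 2 * (q \<bullet> (x - u) + z \<bullet> (g - u))"
proof -
  have "(max (q $ i + x $ i - u $ i) 0)\<^sup>2 + (z $ i + g $ i - u $ i)\<^sup>2
    \<le> (q $ i)\<^sup>2 + (z $ i)\<^sup>2 + 2 * (m $ i)\<^sup>2
      + 2 * (q $ i * (x $ i - u $ i) + z $ i * (g $ i - u $ i))" for i
  proof -
    have "(max (q $ i + x $ i - u $ i) 0)\<^sup>2 \<le> (q $ i + (x $ i - u $ i))\<^sup>2"
      by (simp add: max_def algebra_simps)
    moreover have "(x $ i - u $ i)\<^sup>2 \<le> (m $ i)\<^sup>2" "(g $ i - u $ i)\<^sup>2 \<le> (m $ i)\<^sup>2"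
      using assms by (auto simp: mem_box_cart intro!: square_diff_le_square_bound)
    ultimately show ?thesis
      by (simp add: power2_eq_square algebra_simps)
  qed
  then have "(\<Sum>i\<in>UNIV. (max (q $ i + x $ i - u $ i) 0)\<^sup>2 + (z $ i + g $ i - u $ i)\<^sup>2)
    \<le> (\<Sum>i\<in>UNIV. (q $ i)\<^sup>2 + (z $ i)\<^sup>2 + 2 * (m $ i)\<^sup>2
      + 2 * (q $ i * (x $ i - u $ i) + z $ i * (g $ i - u $ i)))"
    by (intro sum_mono)
  also have "\<dots> = (\<Sum>i\<in>UNIV. (q $ i)\<^sup>2 + (z $ i)\<^sup>2) + 2 * (\<Sum>i\<in>UNIV. (m $ i)\<^sup>2)
      + 2 * (q \<bullet> (x - u) + z \<bullet> (g - u))"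
    by (simp add: inner_vec_def sum.distrib sum_distrib_left)
  finally show ?thesis .
qed

text \<open>Clipping only raises \<open>q\<close> above the unclipped recursion, whose solution from
  0 is the partial sum.\<close>

lemma max_queue_ge_sum:
  fixes q y :: "nat \<Rightarrow> real"
  assumes "q 0 = 0" and "\<And>t. q (Suc t) = max (q t + y t) 0"
  shows "(\<Sum>\<tau><t. y \<tau>) \<le> q t"
  using assms by (induction t) (auto intro: order_trans)

text \<open>Jensen with equal weights \<open>1 / real t\<close>. Membership in \<open>S\<close> is
  stated separately because it also places the average utility in the box, where the Lipschitz bound
  applies.\<close>

lemma jensen_average_concave:
  fixes f :: "'b::real_vector \<Rightarrow> real"
  assumes "concave_on S f" and "\<And>\<tau>. g \<tau> \<in> S" and "t \<ge> 1"
  shows "(1 / real t) *\<^sub>R (\<Sum>\<tau><t. g \<tau>) \<in> S"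
    and "time_avg (\<lambda>\<tau>. f (g \<tau>)) t \<le> f ((1 / real t) *\<^sub>R (\<Sum>\<tau><t. g \<tau>))"
proof -
  have "convex S"
    using assms(1) concave_on_imp_convex by blast
  then have "(\<Sum>\<tau><t. (1 / real t) *\<^sub>R g \<tau>) \<in> S"
    using assms(2,3) by (intro convex_sum) auto
  then show "(1 / real t) *\<^sub>R (\<Sum>\<tau><t. g \<tau>) \<in> S"
    by (simp add: scaleR_sum_right)
  have "{..<t} \<noteq> {}"
    using assms(3) by (simp add: lessThan_empty_iff)
  then have "(\<Sum>\<tau><t. (1 / real t) * f (g \<tau>)) \<le> f (\<Sum>\<tau><t. (1 / real t) *\<^sub>R g \<tau>)"
    using assms by (intro concave_on_sum) auto
  then show "time_avg (\<lambda>\<tau>. f (g \<tau>)) t \<le> f ((1 / real t) *\<^sub>R (\<Sum>\<tau><t. g \<tau>))"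
    by (simp add: time_avg_def scaleR_sum_right sum_distrib_left)
qed

lemma avg_utility_eq_scaleR:
  "avg_utility uhat w a t = (1 / real t) *\<^sub>R (\<Sum>\<tau><t. \<chi> i. uhat i (a \<tau>) (w \<tau>))"
  by (simp add: avg_utility_def time_avg_def vec_eq_iff)

theorem theorem3:
  fixes \<Omega> :: "'w set"
    and A :: "'n::finite \<Rightarrow> 'a set"
    and uhat :: "'n \<Rightarrow> ('n \<Rightarrow> 'a) \<Rightarrow> 'w \<Rightarrow> real"
    and umax :: "real^'n"
    and \<phi> :: "real^'n \<Rightarrow> real"
    and V C :: real
    and w :: "nat \<Rightarrow> 'w"
    and b \<alpha> :: "nat \<Rightarrow> 'n \<Rightarrow> 'a"
    and \<gamma> Q Z :: "nat \<Rightarrow> real^'n"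
  assumes "CARD('n) \<ge> 2"
    and "stochastic_game \<Omega> A uhat umax"
    and "concave_on (cbox 0 umax) \<phi>"
    and "continuous_on (cbox 0 umax) \<phi>"
    and "\<And>g. g \<in> cbox 0 umax \<Longrightarrow> 0 \<le> \<phi> g"
    and "C = (\<Sum>i\<in>UNIV. (umax $ i)\<^sup>2)"
    and "V \<ge> 0"
    and "\<And>t. w t \<in> \<Omega>"
    and "\<And>t. b t \<in> profiles A"
    and "general_algorithm A uhat umax \<phi> V w b \<gamma> \<alpha> Q Z"
    and "Q 0 = 0" and "Z 0 = 0"
  shows
    "(\<forall>t\<ge>1. sqrt (\<Sum>i\<in>UNIV. (Q t $ i)\<^sup>2 + (Z t $ i)\<^sup>2) / real t
        \<le> sqrt ((2 * C + 2 * V * phi_max umax \<phi>) / real t)) \<and>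
     (\<forall>t\<ge>1. \<forall>i. avg_utility uhat w \<alpha> t $ i - avg_utility uhat w b t $ i
        \<ge> - sqrt ((2 * C + 2 * V * phi_max umax \<phi>) / real t)) \<and>
     ((\<forall>i. liminf (\<lambda>t. ereal (avg_utility uhat w \<alpha> t $ i - avg_utility uhat w b t $ i)) \<ge> 0) \<and>
      (\<forall>i t. \<alpha> t i \<in> A i)) \<and>
     (\<forall>M>0. M-lipschitz_on (cbox 0 umax) \<phi> \<longrightarrow>
        (\<forall>t\<ge>1. \<phi> (avg_utility uhat w \<alpha> t)
          \<ge> time_avg (\<lambda>\<tau>. \<phi> (\<gamma> \<tau>)) t - M * sqrt ((2 * C + 2 * V * phi_max umax \<phi>) / real t)))"
proof -
  \<comment> \<open>Growth of \<open>L\<close> per round: \<open>2 * C\<close> from the squared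
    increments, plus twice the bound on the cross term.\<close>
  define K where "K = 2 * C + 2 * V * phi_max umax \<phi>"
  define x where "x = (\<lambda>t. \<chi> i. uhat i (b t) (w t))"
  define u where "u = (\<lambda>t. \<chi> i. uhat i (\<alpha> t) (w t))"
  define L where "L = (\<lambda>t. \<Sum>i\<in>UNIV. (Q t $ i)\<^sup>2 + (Z t $ i)\<^sup>2)"
  have argmax_\<gamma>: "is_arg_max (\<lambda>g. V * \<phi> g - Z t \<bullet> g) (\<lambda>g. g \<in> cbox 0 umax) (\<gamma> t)"
    and argmax_\<alpha>: "is_arg_max (\<lambda>a. \<Sum>i\<in>UNIV. uhat i a (w t) * (Q t $ i + Z t $ i))
          (\<lambda>a. a \<in> profiles A) (\<alpha> t)"
    and Q_Suc: "Q (Suc t) $ i = max (Q t $ i + x t $ i - u t $ i) 0"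
    and Z_Suc: "Z (Suc t) $ i = Z t $ i + \<gamma> t $ i - u t $ i" for t i
    using assms(10) by (auto simp: general_algorithm_def x_def u_def inner_vec_def)
  have \<alpha>: "\<alpha> t \<in> profiles A" for t
    using argmax_\<alpha>[of t] by (simp add: is_arg_max_def)
  have \<gamma>: "\<gamma> t \<in> cbox 0 umax" for t
    using argmax_\<gamma>[of t] by (simp add: is_arg_max_def)
  have x: "x t \<in> cbox 0 umax" and u: "u t \<in> cbox 0 umax" for t
    using assms(2) assms(8,9)[of t] \<alpha>[of t]
    by (auto simp: stochastic_game_def x_def u_def mem_box_cart)
  have \<phi>_le: "\<phi> g \<le> phi_max umax \<phi>" if "g \<in> cbox 0 umax" for g
    using phi_max_attained[OF assms(4)] that by force
  have avg_u: "avg_utility uhat w \<alpha> t = (1 / real t) *\<^sub>R (\<Sum>\<tau><t. u \<tau>)"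
    and avg_x: "avg_utility uhat w b t = (1 / real t) *\<^sub>R (\<Sum>\<tau><t. x \<tau>)" for t
    by (simp_all add: avg_utility_eq_scaleR u_def x_def)

  have step: "L (Suc t) \<le> L t + K" for t
  proof -
    \<comment> \<open>With \<open>x t\<close> as competitor of \<open>\<gamma> t\<close>, the term
      \<open>Z t \<bullet> x t\<close> cancels against the one in the \<open>\<alpha>\<close>
      comparison below. Non-negativity of \<open>\<phi>\<close> then lets
      \<open>V * \<phi> (x t)\<close> be dropped.\<close>
    have "V * \<phi> (x t) - Z t \<bullet> x t \<le> V * \<phi> (\<gamma> t) - Z t \<bullet> \<gamma> t"
      using argmax_\<gamma>[of t] x[of t] by (simp add: is_arg_max_linorder)
    moreover have "0 \<le> V * \<phi> (x t)" "V * \<phi> (\<gamma> t) \<le> V * phi_max umax \<phi>"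
      using assms(5)[OF x] assms(7) \<phi>_le[OF \<gamma>] by (auto intro: mult_left_mono)
    moreover have "x t \<bullet> (Q t + Z t) \<le> u t \<bullet> (Q t + Z t)"
      using argmax_\<alpha>[of t] assms(9)[of t]
      by (simp add: is_arg_max_linorder inner_vec_def x_def u_def)
    ultimately have "Q t \<bullet> (x t - u t) + Z t \<bullet> (\<gamma> t - u t) \<le> V * phi_max umax \<phi>"
      by (simp add: inner_diff_right inner_add_right inner_commute)
    then show ?thesis
      using queue_drift[OF x[of t] u[of t] \<gamma>[of t], where q = "Q t" and z = "Z t"]
      by (simp add: L_def Q_Suc Z_Suc K_def assms(6))
  qed
  have L_le: "L t \<le> K * real t" for t
  proof (induction t)
    case 0
    then show ?case by (simp add: L_def assms(11,12))
  next
    case (Suc t)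
    then show ?case using step[of t] by (simp add: algebra_simps)
  qed
  have a: "sqrt (L t) / real t \<le> sqrt (K / real t)" if "t \<ge> 1" for t
  proof -
    \<comment> \<open>Under the root the divisor becomes a square, so linear growth of
      \<open>L\<close> leaves decay of order \<open>1 / real t\<close>.\<close>
    have "sqrt (L t) / real t = sqrt (L t / (real t)\<^sup>2)"
      by (simp add: real_sqrt_divide)
    also have "\<dots> \<le> sqrt (K * real t / (real t)\<^sup>2)"
      using L_le[of t] by (intro real_sqrt_le_mono divide_right_mono) auto
    also have "\<dots> = sqrt (K / real t)"
      by (simp add: power2_eq_square)
    finally show ?thesis .
  qed
  have b: "avg_utility uhat w \<alpha> t $ i - avg_utility uhat w b t $ i \<ge> - sqrt (K / real t)"
    if "t \<ge> 1" for t i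
  proof -
    have "(\<Sum>\<tau><t. x \<tau> $ i - u \<tau> $ i) \<le> Q t $ i"
      by (rule max_queue_ge_sum) (simp_all add: assms(11) Q_Suc algebra_simps)
    \<comment> \<open>The right-hand side is the root of a single summand of
      \<open>L t\<close>.\<close>
    also have "\<dots> \<le> sqrt ((Q t $ i)\<^sup>2 + (Z t $ i)\<^sup>2)"
      by (rule real_le_rsqrt) simp
    also have "\<dots> \<le> sqrt (L t)"
      unfolding L_def by (intro real_sqrt_le_mono member_le_sum) auto
    finally have "(\<Sum>\<tau><t. x \<tau> $ i - u \<tau> $ i) / real t \<le> sqrt (L t) / real t"
      by (rule divide_right_mono) simp
    with a[OF that] show ?thesis
      by (simp add: avg_u avg_x sum_subtractf diff_divide_distrib)
  qed
  have c: "liminf (\<lambda>t. ereal (avg_utility uhat w \<alpha> t $ i - avg_utility uhat w b t $ i)) \<ge> 0" for i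
  proof -
    have "(\<lambda>t. - sqrt (K / real t)) \<longlonglongrightarrow> - sqrt 0"
      by (intro tendsto_intros lim_const_over_n)
    then have "(\<lambda>t. ereal (- sqrt (K / real t))) \<longlonglongrightarrow> 0"
      by (simp add: zero_ereal_def)
    then have "liminf (\<lambda>t. ereal (- sqrt (K / real t))) = 0"
      by (intro lim_imp_Liminf) auto
    \<comment> \<open>The bound \<open>b\<close> is available from round 1 on, and an eventual
      comparison suffices for the liminf.\<close>
    moreover have "liminf (\<lambda>t. ereal (- sqrt (K / real t)))
        \<le> liminf (\<lambda>t. ereal (avg_utility uhat w \<alpha> t $ i - avg_utility uhat w b t $ i))"
      using b by (intro Liminf_mono eventually_sequentiallyI[of 1]) simp
    ultimately show ?thesis by simp
  qed
  \<comment> \<open>\<open>Z\<close> is not clipped, so its recursion telescopes to an equality.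
    Hence its norm controls the gap between the averages in both directions, as the Lipschitz
    estimate requires.\<close>
  have Z_eq: "Z t = (\<Sum>\<tau><t. \<gamma> \<tau> - u \<tau>)" for t
    by (induction t) (simp_all add: assms(12) vec_eq_iff Z_Suc algebra_simps)
  have d: "\<phi> (avg_utility uhat w \<alpha> t) \<ge> time_avg (\<lambda>\<tau>. \<phi> (\<gamma> \<tau>)) t - M * sqrt (K / real t)"
    if "M > 0" "M-lipschitz_on (cbox 0 umax) \<phi>" "t \<ge> 1" for M t
  proof -
    \<comment> \<open>The average of the \<open>\<gamma> \<tau>\<close> is the intermediate point:
      Jensen bounds \<open>\<phi> g\<close> from below, and \<open>g\<close> differs from the
      average utility by exactly \<open>Z t\<close> scaled by \<open>1 / real t\<close>.\<close>
    define g where "g = (1 / real t) *\<^sub>R (\<Sum>\<tau><t. \<gamma> \<tau>)"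
    have g: "g \<in> cbox 0 umax" "time_avg (\<lambda>\<tau>. \<phi> (\<gamma> \<tau>)) t \<le> \<phi> g"
      unfolding g_def using jensen_average_concave[OF assms(3) \<gamma> that(3)] by auto
    have "avg_utility uhat w \<alpha> t \<in> cbox 0 umax"
      unfolding avg_u using jensen_average_concave(1)[OF assms(3) u that(3)] .
    then have "\<phi> g - \<phi> (avg_utility uhat w \<alpha> t) \<le> M * dist g (avg_utility uhat w \<alpha> t)"
      using lipschitz_onD[OF that(2) g(1)] by (force simp: dist_real_def)
    also have "dist g (avg_utility uhat w \<alpha> t) = norm (Z t) / real t"
      by (simp add: dist_norm g_def avg_u Z_eq sum_subtractf flip: scaleR_diff_right)
    also have "norm (Z t) \<le> sqrt (L t)"
      by (auto simp: norm_vec_def L2_set_def L_def intro!: sum_mono)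
    \<comment> \<open>Since \<open>M > 0\<close>, the bound on \<open>norm (Z t)\<close> may be
      substituted under multiplication by \<open>M\<close> and division by
      \<open>real t\<close>.\<close>
    finally have "\<phi> g - \<phi> (avg_utility uhat w \<alpha> t) \<le> M * (sqrt (L t) / real t)"
      using that(1) by (simp add: divide_right_mono)
    also have "\<dots> \<le> M * sqrt (K / real t)"
      using a[OF that(3)] that(1) by (intro mult_left_mono) auto
    finally show ?thesis using g(2) by simp
  qed
  have "\<alpha> t i \<in> A i" for t i
    using \<alpha>[of t] by (auto simp: profiles_def)
  with a b c d show ?thesis
    unfolding L_def K_def by blast
qed

end
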